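(* Let $G=(V,E)$ be an undirected graph on $n$ vertices with edge weights $w:E\to\{0,1,\dots,W\}$, let $r$ be a VC-SNDP requirement function on $G$ with maximum requirement $k=\max_{u,v} r(uv)$, and let $t\ge 1$ be an integer. Let $H$ be the output of the streaming greedy vertex-fault-tolerant spanner algorithm (described in the context) run on the edges of $G$, presented in an arbitrary order, with parameters $t$, $f=(2t-2)(k-1)$ and $\epsilon=1/(2t-1)$. Then the minimum weight of a feasible solution of the VC-SNDP instance $(H,r)$ is at most $2tk$ times the minimum weight of a feasible solution of the VC-SNDP instance $(G,r)$.
   Context: VC-SNDP: given an undirected graph $G=(V,E)$ with nonnegative edge weights and an integer requirement $r(uv)\ge 0$ for each unordered pair $u,v\in V$, a feasible solution is a subgraph $H'\subseteq G$ (edge subset) such that for every pair $u,v$, $H'$ contains $r(uv)$ internally vertex-disjoint $uv$-paths; the goal is to minimize the total weight of $H'$. We assume the instance on $G$ is feasible. Streaming greedy vertex-fault-tolerant (VFT) spanner algorithm with parameters $(t,f,\epsilon)$: partition possible weights into buckets $B_0=\{0\}$ and $B_i=[(1+\epsilon)^{i-1},(1+\epsilon)^{i})$ for $i=1,\dots,T$ with $T=O(\epsilon^{-1}\log W)$ large enough to cover $\{1,\dots,W\}$. Initialize $H_i=(V,\emptyset)$ for every bucket $i$. Process the edges one at a time in the stream order; for an edge $(u,v)$ with $w(u,v)\in B_j$, add $(u,v)$ to $H_j$ if there exists a set $F\subseteq V\setminus\{u,v\}$ of at most $f$ vertices such that $d_{H_j\setminus F}(u,v)>2t-1$, where $d$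 denotes unweighted (hop) distance ($\infty$ if disconnected) and $H_j\setminus F$ is the subgraph induced on $V\setminus F$. Output $H=H_0\cup H_1\cup\dots\cup H_T$. *)

theory Defs
  imports Complex_Main "HOL-Library.Extended_Nat"
begin

text \<open>A graph is given by its vertex set and its set of edges, an edge being a two-element
  set of vertices.\<close>

definition vpairs :: "'a set \<Rightarrow> 'a set set" where
  "vpairs V = {{u, v} | u v. u \<in> V \<and> v \<in> V \<and> u \<noteq> v}"

definition ugraph :: "'a set \<Rightarrow> 'a set set \<Rightarrow> bool" where
  "ugraph V E \<longleftrightarrow> finite V \<and> E \<subseteq> vpairs V"

definition is_path :: "'a set set \<Rightarrow> 'a \<Rightarrow> 'a \<Rightarrow> 'a list \<Rightarrow> bool" where
  "is_path E u v p \<longleftrightarrow> p \<noteq> [] \<and> hd p = u \<and> last p = v \<and> distinct p \<and>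
     (\<forall>i. Suc i < length p \<longrightarrow> {p ! i, p ! Suc i} \<in> E)"

definition hop_dist :: "'a set set \<Rightarrow> 'a \<Rightarrow> 'a \<Rightarrow> enat" where
  "hop_dist E u v = (INF p \<in> {p. is_path E u v p}. enat (length p - 1))"

definition induced_edges :: "'a set set \<Rightarrow> 'a set \<Rightarrow> 'a set set" where
  "induced_edges E U = {e \<in> E. e \<subseteq> U}"

text \<open>The paths form a set of vertex lists, so in particular the one-edge path between the two
  endpoints is counted at most once.\<close>

definition has_disjoint_paths :: "'a set set \<Rightarrow> 'a \<Rightarrow> 'a \<Rightarrow> nat \<Rightarrow> bool" where
  "has_disjoint_paths E u v m \<longleftrightarrow>
     (\<exists>P. finite P \<and> card P = m \<and> (\<forall>p\<in>P. is_path E u v p) \<and>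
        (\<forall>p\<in>P. \<forall>q\<in>P. p \<noteq> q \<longrightarrow> (set p - {u, v}) \<inter> (set q - {u, v}) = {}))"

definition vc_sndp_solution ::
    "'a set \<Rightarrow> 'a set set \<Rightarrow> ('a set \<Rightarrow> nat) \<Rightarrow> 'a set set \<Rightarrow> bool" where
  "vc_sndp_solution V E r X \<longleftrightarrow>
     X \<subseteq> E \<and> (\<forall>u\<in>V. \<forall>v\<in>V. u \<noteq> v \<longrightarrow> has_disjoint_paths X u v (r {u, v}))"

definition vc_sndp_feasible :: "'a set \<Rightarrow> 'a set set \<Rightarrow> ('a set \<Rightarrow> nat) \<Rightarrow> bool" where
  "vc_sndp_feasible V E r \<longleftrightarrow> (\<exists>X. vc_sndp_solution V E r X)"

text \<open>Only meaningful for feasible instances, since \<open>Min {}\<close> is unspecified.\<close>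

definition vc_sndp_opt ::
    "'a set \<Rightarrow> 'a set set \<Rightarrow> ('a set \<Rightarrow> nat) \<Rightarrow> ('a set \<Rightarrow> nat) \<Rightarrow> nat" where
  "vc_sndp_opt V E r w = Min {\<Sum>e\<in>X. w e | X. vc_sndp_solution V E r X}"

fun bucket :: "real \<Rightarrow> nat \<Rightarrow> real set" where
  "bucket \<epsilon> 0 = {0}"
| "bucket \<epsilon> (Suc i) = {(1 + \<epsilon>) ^ i ..< (1 + \<epsilon>) ^ Suc i}"

text \<open>The number of faults is an integer because \<open>(2t - 2)(k - 1)\<close> is negative for \<open>k = 0\<close>
  and \<open>t > 1\<close>.\<close>

definition vft_add :: "'a set \<Rightarrow> nat \<Rightarrow> int \<Rightarrow> 'a set set \<Rightarrow> 'a set \<Rightarrow> bool" where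
  "vft_add V t f H e \<longleftrightarrow>
     (\<exists>u v F. e = {u, v} \<and> F \<subseteq> V - {u, v} \<and> int (card F) \<le> f \<and>
        hop_dist (induced_edges H (V - F)) u v > enat (2 * t - 1))"

definition vft_step ::
    "'a set \<Rightarrow> ('a set \<Rightarrow> nat) \<Rightarrow> nat \<Rightarrow> int \<Rightarrow> real \<Rightarrow> nat \<Rightarrow> 'a set \<Rightarrow>
     (nat \<Rightarrow> 'a set set) \<Rightarrow> (nat \<Rightarrow> 'a set set)" where
  "vft_step V w t f \<epsilon> T e H =
     (\<lambda>j. if j \<le> T \<and> real (w e) \<in> bucket \<epsilon> j \<and> vft_add V t f (H j) e
          then insert e (H j) else H j)"

definition vft_spanner ::
    "'a set \<Rightarrow> ('a set \<Rightarrow> nat) \<Rightarrow> nat \<Rightarrow> int \<Rightarrow> real \<Rightarrow> nat \<Rightarrow> 'a set list \<Rightarrow> 'a set set" where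
  "vft_spanner V w t f \<epsilon> T es = (\<Union>j\<le>T. fold (vft_step V w t f \<epsilon> T) es (\<lambda>_. {}) j)"

end

theory Submission
  imports Defs
begin

text \<open>A rejected edge \<open>xy\<close> of bucket \<open>j\<close> survives every fault set of size \<open>(2t - 2)(k - 1)\<close> with an
  \<open>xy\<close>-path of at most \<open>2t - 1\<close> hops in \<open>H\<^sub>j\<close>. Deleting the at most \<open>2t - 2\<close> interior vertices of
  the paths found so far therefore produces, one after the other, \<open>k\<close> internally disjoint short
  paths, of total weight at most \<open>k (2t - 1) (1 + \<epsilon>) w(xy) = 2tk w(xy)\<close>. Replace each edge of an
  optimal solution that is missing from \<open>H\<close> by these detours. A set of fewer than \<open>r(uv) \<le> k\<close>
  vertices (or vertices and the edge \<open>uv\<close>) misses one of the \<open>uv\<close>-paths of the optimal solution and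
  then one of the \<open>k\<close> detours of each replaced edge on it, so the new edge set contains \<open>r(uv)\<close>
  disjoint paths by Menger's theorem. The latter is proved by Goering's induction on the edges: if
  \<open>S\<close> is a separator of size \<open>m - 1\<close> after deletion of the edge \<open>(x, y)\<close>, then \<open>m\<close> disjoint paths
  from \<open>A\<close> to \<open>S \<union> {x}\<close> and \<open>m\<close> disjoint paths from \<open>S \<union> {y}\<close> to \<open>B\<close> meet only in \<open>S\<close> and can be
  joined.\<close>

subsection \<open>Menger's theorem\<close>

text \<open>Quantifying over walks instead of paths lets spliced walks be tested against
  \<open>S\<close> without first removing repetitions. \<open>S\<close> may meet \<open>A\<close>
  and \<open>B\<close>.\<close>

definition separates :: "('a \<Rightarrow> 'a \<Rightarrow> bool) \<Rightarrow> 'a set \<Rightarrow> 'a set \<Rightarrow> 'a set \<Rightarrow> bool" where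
  "separates R A B S \<longleftrightarrow>
     (\<forall>p. p \<noteq> [] \<longrightarrow> successively R p \<longrightarrow> hd p \<in> A \<longrightarrow> last p \<in> B \<longrightarrow> set p \<inter> S \<noteq> {})"

text \<open>A single vertex of \<open>A \<inter> B\<close> counts as a path. Disjointness includes
  the end vertices, so different paths have different ends.\<close>

definition linkage :: "('a \<Rightarrow> 'a \<Rightarrow> bool) \<Rightarrow> 'a set \<Rightarrow> 'a set \<Rightarrow> 'a list set \<Rightarrow> bool" where
  "linkage R A B P \<longleftrightarrow>
     (\<forall>p\<in>P. p \<noteq> [] \<and> successively R p \<and> distinct p \<and> hd p \<in> A \<and> last p \<in> B) \<and>
     (\<forall>p\<in>P. \<forall>q\<in>P. p \<noteq> q \<longrightarrow> set p \<inter> set q = {})"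

lemma separatesD:
  "separates R A B S \<Longrightarrow> p \<noteq> [] \<Longrightarrow> successively R p \<Longrightarrow> hd p \<in> A \<Longrightarrow> last p \<in> B
    \<Longrightarrow> set p \<inter> S \<noteq> {}"
  by (simp add: separates_def)

lemma linkage_mono: "linkage R A B P \<Longrightarrow> (\<And>a b. R a b \<Longrightarrow> R' a b) \<Longrightarrow> linkage R' A B P"
  unfolding linkage_def by (auto intro: successively_mono[of R _ R'])

lemma linkageD:
  assumes "linkage R A B P" and "p \<in> P"
  shows "p \<noteq> []" "successively R p" "distinct p" "hd p \<in> A" "last p \<in> B"
  using assms by (auto simp: linkage_def)

lemma linkage_disjoint:
  "linkage R A B P \<Longrightarrow> p \<in> P \<Longrightarrow> q \<in> P \<Longrightarrow> z \<in> set p \<Longrightarrow> z \<in> set q \<Longrightarrow> p = q"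
  unfolding linkage_def by blast

lemma linkage_inj_hd: "linkage R A B P \<Longrightarrow> inj_on hd P"
  by (rule inj_onI) (metis hd_in_set linkageD(1) linkage_disjoint)

lemma linkage_inj_last: "linkage R A B P \<Longrightarrow> inj_on last P"
  by (rule inj_onI) (metis last_in_set linkageD(1) linkage_disjoint)

text \<open>A step along the new edge \<open>(x, y)\<close> would put \<open>x\<close> before the
  last position and \<open>y\<close> after the first.\<close>

lemma successively_insert_edge:
  assumes "successively (\<lambda>a b. R a b \<or> a = x \<and> b = y) p" and "x \<notin> set (butlast p) \<or> y \<notin> set (tl p)"
  shows "successively R p"
  using assms
proof (induction p)
  case (Cons a p)
  then show ?case by (cases p) (auto split: if_splits dest: in_set_butlastD list.set_sel(2))
qed simp

text \<open>A walk that avoids \<open>insert x S\<close> never leaves \<open>x\<close>, so it runs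
  in \<open>R\<close> and contradicts \<open>sep\<close>. Up to its first hit of
  \<open>insert x S\<close>, a walk has \<open>x\<close> at most as last vertex, so this prefix runs
  in \<open>R\<close> and \<open>S'\<close> meets it. In Menger's theorem this bounds the size of
  \<open>S'\<close> from below.\<close>

lemma separates_insert_edge_tail:
  assumes sep: "separates R A B S" and S': "separates R A (insert x S) S'"
  shows "separates (\<lambda>a b. R a b \<or> a = x \<and> b = y) A B S'"
  unfolding separates_def
proof (intro allI impI)
  fix p assume p: "p \<noteq> []" "successively (\<lambda>a b. R a b \<or> a = x \<and> b = y) p" "hd p \<in> A" "last p \<in> B"
  have "\<exists>z\<in>set p. z \<in> insert x S"
  proof (rule ccontr)
    assume no: "\<not> ?thesis"
    then have "successively R p"
      using p(2) by (intro successively_insert_edge[of R x y]) (auto dest: in_set_butlastD)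
    with separatesD[OF sep p(1)] p no show False by blast
  qed
  then obtain ys z zs where dec: "p = ys @ z # zs" "z \<in> insert x S" "\<forall>y\<in>set ys. y \<notin> insert x S"
    using split_list_first_prop[of p "\<lambda>z. z \<in> insert x S"] by blast
  have "successively R (ys @ [z])"
    using p(2) dec by (intro successively_insert_edge[of R x y])
      (auto simp: successively_append_iff dest: in_set_butlastD)
  moreover have "hd (ys @ [z]) \<in> A" using p(3) dec by (cases ys) auto
  ultimately have "set (ys @ [z]) \<inter> S' \<noteq> {}"
    using separatesD[OF S', of "ys @ [z]"] dec(2) by simp
  then show "set p \<inter> S' \<noteq> {}" using dec by auto
qed

lemma separates_insert_edge_head:
  assumes sep: "separates R A B S" and S': "separates R (insert y S) B S'"
  shows "separates (\<lambda>a b. R a b \<or> a = x \<and> b = y) A B S'"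
  unfolding separates_def
proof (intro allI impI)
  fix p assume p: "p \<noteq> []" "successively (\<lambda>a b. R a b \<or> a = x \<and> b = y) p" "hd p \<in> A" "last p \<in> B"
  have "\<exists>z\<in>set p. z \<in> insert y S"
  proof (rule ccontr)
    assume no: "\<not> ?thesis"
    then have "successively R p"
      using p(1,2) by (intro successively_insert_edge[of R x y]) (auto dest: list.set_sel(2))
    with separatesD[OF sep p(1)] p no show False by blast
  qed
  then obtain ys z zs where dec: "p = ys @ z # zs" "z \<in> insert y S" "\<forall>a\<in>set zs. a \<notin> insert y S"
    using split_list_last_prop[of p "\<lambda>z. z \<in> insert y S"] by blast
  have "successively R (z # zs)"
    using p(2) dec by (intro successively_insert_edge[of R x y])
      (auto simp: successively_append_iff)
  then have "set (z # zs) \<inter> S' \<noteq> {}"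
    using separatesD[OF S', of "z # zs"] dec p(4) by simp
  then show "set p \<inter> S' \<noteq> {}" using dec by auto
qed

text \<open>The ends of \<open>P\<close> exhaust \<open>insert x S\<close>, so by disjointness a
  path of \<open>P\<close> meets \<open>S\<close> only in its own end; likewise for the starts of
  \<open>Q\<close>. A common vertex outside \<open>S\<close> would give a spliced walk from
  \<open>A\<close> to \<open>B\<close>, which would have to meet \<open>S\<close> before the end of
  \<open>p\<close> or after the start of \<open>q\<close>.\<close>

lemma linkage_meet_separator:
  assumes sep: "separates R A B S"
    and P: "linkage R A (insert x S) P" "last ` P = insert x S"
    and Q: "linkage R (insert y S) B Q" "hd ` Q = insert y S"
    and p: "p \<in> P" "z \<in> set p" and q: "q \<in> Q" "z \<in> set q"
  shows "z \<in> S \<and> last p = z \<and> hd q = z"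
proof -
  have last_eq: "last p = s" if "s \<in> S" "s \<in> set p" for s
  proof -
    have "s \<in> last ` P" using P(2) that(1) by simp
    then obtain p' where p': "p' \<in> P" "s = last p'" by (rule imageE) simp
    then have "p = p'"
      using linkage_disjoint[OF P(1) p(1) p'(1) that(2)] linkageD(1)[OF P(1) p'(1)] by simp
    then show ?thesis using p'(2) by simp
  qed
  have hd_eq: "hd q = s" if "s \<in> S" "s \<in> set q" for s
  proof -
    have "s \<in> hd ` Q" using Q(2) that(1) by simp
    then obtain q' where q': "q' \<in> Q" "s = hd q'" by (rule imageE) simp
    then have "q = q'"
      using linkage_disjoint[OF Q(1) q(1) q'(1) that(2)] linkageD(1)[OF Q(1) q'(1)] by simp
    then show ?thesis using q'(2) by simp
  qed
  have "z \<in> S"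
  proof (rule ccontr)
    assume z: "z \<notin> S"
    obtain p1 p2 where p12: "p = p1 @ z # p2" using p(2) by (meson split_list)
    obtain q1 q2 where q12: "q = q1 @ z # q2" using q(2) by (meson split_list)
    have "successively R (p1 @ z # q2)"
      using linkageD(2)[OF P(1) p(1)] linkageD(2)[OF Q(1) q(1)] p12 q12
      by (auto simp: successively_append_iff)
    moreover have "hd (p1 @ z # q2) \<in> A" using linkageD(4)[OF P(1) p(1)] p12 by (cases p1) auto
    moreover have "last (p1 @ z # q2) \<in> B" using linkageD(5)[OF Q(1) q(1)] q12 by auto
    ultimately obtain s where s: "s \<in> S" "s \<in> set (p1 @ z # q2)"
      using separatesD[OF sep, of "p1 @ z # q2"] by blast
    then consider "s \<in> set p1" | "s \<in> set q2" using z by auto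
    then show False
    proof cases
      case 1
      then have "last (z # p2) = s" using last_eq s p12 by auto
      then have "s \<in> set (z # p2)" by (metis last_in_set list.distinct(1))
      then show False using 1 linkageD(3)[OF P(1) p(1)] p12 by auto
    next
      case 2
      then have "hd (q1 @ [z]) = s" using hd_eq s q12 by (cases q1) auto
      then have "s \<in> set (q1 @ [z])" by (metis hd_in_set append_is_Nil_conv list.distinct(1))
      then show False using 2 linkageD(3)[OF Q(1) q(1)] q12 by auto
    qed
  qed
  then show ?thesis using last_eq hd_eq p q by blast
qed

text \<open>A path ending in \<open>S\<close> is continued by the path of \<open>Q\<close> that
  starts there, and the path ending in \<open>x\<close> by the one starting in \<open>y\<close>,
  over the new edge.\<close>

lemma linkage_join:
  assumes sep: "separates R A B S" and xy: "x \<notin> S" "y \<notin> S"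
    and P: "linkage R A (insert x S) P" "last ` P = insert x S"
    and Q: "linkage R (insert y S) B Q" "hd ` Q = insert y S"
  shows "\<exists>L. linkage (\<lambda>a b. R a b \<or> a = x \<and> b = y) A B L \<and> card L = card P"
proof -
  let ?R = "\<lambda>a b. R a b \<or> a = x \<and> b = y"
  note meet = linkage_meet_separator[OF sep P Q]
  have "\<exists>q\<in>Q. hd q = (if last p = x then y else last p)" if "p \<in> P" for p
  proof -
    have "(if last p = x then y else last p) \<in> hd ` Q" using that P(2) Q(2) by auto
    then show ?thesis by (metis imageE)
  qed
  then obtain g where g: "\<And>p. p \<in> P \<Longrightarrow> g p \<in> Q"
      "\<And>p. p \<in> P \<Longrightarrow> hd (g p) = (if last p = x then y else last p)"
    by metis
  have g_inj: "p = p'" if "p \<in> P" "p' \<in> P" "g p = g p'" for p p'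
  proof -
    have "last p \<in> insert x S" "last p' \<in> insert x S" using that P(2) by auto
    moreover have "(if last p = x then y else last p) = (if last p' = x then y else last p')"
      using g(2) that by metis
    ultimately have "last p = last p'" using xy by (auto split: if_splits)
    then show ?thesis using linkage_inj_last[OF P(1)] that by (meson inj_onD)
  qed
  \<comment> \<open>If \<open>p\<close> ends in \<open>S\<close>, then \<open>g p\<close> starts
    with that same vertex, which is dropped; across the edge \<open>(x, y)\<close> nothing is
    shared.\<close>
  define J where "J p = p @ (if last p = x then g p else tl (g p))" for p
  have ne: "p \<noteq> []" "g p \<noteq> []" if "p \<in> P" for p
    using that linkageD(1)[OF P(1)] linkageD(1)[OF Q(1)] g by auto
  have set_J: "set (J p) = set p \<union> set (g p)" if "p \<in> P" for p
  proof (cases "last p = x")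
    case False
    then have "g p = last p # tl (g p)" using g(2)[OF that] ne[OF that] by (metis list.collapse)
    then have "set (g p) = insert (last p) (set (tl (g p)))" by (metis list.simps(15))
    then show ?thesis using False ne[OF that] by (auto simp: J_def)
  qed (simp add: J_def)
  have J_disj: "p = p'" if "p \<in> P" "p' \<in> P" "z \<in> set (J p)" "z \<in> set (J p')" for p p' z
  proof -
    \<comment> \<open>A shared vertex lies in \<open>S\<close>, ends \<open>a\<close> and therefore
      starts both \<open>g a\<close> and \<open>g b\<close>.\<close>
    have cross: "a = b" if ab: "a \<in> P" "b \<in> P" "z \<in> set a" "z \<in> set (g b)" for a b
    proof -
      have m: "z \<in> S" "last a = z" "hd (g b) = z" using meet[OF ab(1,3) g(1)[OF ab(2)] ab(4)] by auto
      then have "hd (g a) = hd (g b)" using g(2)[OF ab(1)] xy by auto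
      then have "g a = g b" using linkage_inj_hd[OF Q(1)] g(1) ab by (meson inj_onD)
      then show ?thesis using g_inj ab by blast
    qed
    from that set_J consider "z \<in> set p" "z \<in> set p'" | "z \<in> set p" "z \<in> set (g p')"
      | "z \<in> set (g p)" "z \<in> set p'" | "z \<in> set (g p)" "z \<in> set (g p')" by blast
    then show ?thesis
    proof cases
      case 1 then show ?thesis using linkage_disjoint[OF P(1)] that by blast
    next
      case 4 then show ?thesis using linkage_disjoint[OF Q(1)] g(1) g_inj that by blast
    qed (use cross that in auto)
  qed
  have "J p \<noteq> [] \<and> successively ?R (J p) \<and> distinct (J p) \<and> hd (J p) \<in> A \<and> last (J p) \<in> B"
    if p: "p \<in> P" for p
  proof -
    note Pp = linkageD[OF P(1) p] and Qp = linkageD[OF Q(1) g(1)[OF p]]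
    have s: "successively ?R p" "successively ?R (g p)"
      using Pp(2) Qp(2) by (auto elim: successively_mono)
    have hdJ: "hd (J p) \<in> A" using Pp by (simp add: J_def)
    show ?thesis
    proof (cases "last p = x")
      case True
      have "set p \<inter> set (g p) = {}" using meet[OF p _ g(1)[OF p]] True xy by blast
      then show ?thesis using True hdJ s Pp Qp g(2)[OF p] by (simp add: J_def successively_append_iff)
    next
      case False
      obtain c where c: "g p = last p # c" using g(2)[OF p] ne[OF p] False by (metis list.collapse)
      have "set p \<inter> set c = {}"
        using meet[OF p _ g(1)[OF p]] c Qp(3) by fastforce
      moreover have "last (J p) = last (g p)" using c False Pp by (auto simp: J_def)
      ultimately show ?thesis using False hdJ s Pp Qp c
        by (cases c) (auto simp: J_def successively_append_iff)
    qed
  qed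
  moreover have "inj_on J P"
    using J_disj ne(1) set_J by (intro inj_onI) (metis UnI1 last_in_set)
  moreover from this have "card (J ` P) = card P" by (rule card_image)
  moreover have "set a \<inter> set b = {}" if "a \<in> J ` P" "b \<in> J ` P" "a \<noteq> b" for a b
    using that J_disj by blast
  ultimately have "linkage ?R A B (J ` P)" "card (J ` P) = card P"
    unfolding linkage_def by auto
  then show ?thesis by (intro exI[of _ "J ` P"] conjI)
qed

theorem menger:
  fixes R :: "'a \<Rightarrow> 'a \<Rightarrow> bool"
  assumes "finite {(a, b). R a b}" and "finite A" and "finite B"
    and "\<And>S. finite S \<Longrightarrow> separates R A B S \<Longrightarrow> k \<le> card S"
  shows "\<exists>P. linkage R A B P \<and> finite P \<and> card P = k"
proof -
  \<comment> \<open>The edges become a finite set of pairs to allow induction. \<open>A\<close> and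
    \<open>B\<close> vary because the hypothesis is applied with \<open>insert x S\<close> as target
    and with \<open>insert y S\<close> as source.\<close>
  have main: "\<exists>P. linkage (\<lambda>a b. (a, b) \<in> D) A B P \<and> finite P \<and> card P = k"
    if "finite D" "finite A" "finite B"
      "\<And>S. finite S \<Longrightarrow> separates (\<lambda>a b. (a, b) \<in> D) A B S \<Longrightarrow> k \<le> card S"
    for D :: "('a \<times> 'a) set" and A B
    using that
  proof (induction D arbitrary: A B)
    case empty
    \<comment> \<open>Without edges every walk is a single vertex.\<close>
    have "separates (\<lambda>a b. (a, b) \<in> {}) A B (A \<inter> B)"
      unfolding separates_def
    proof (intro allI impI)
      fix p :: "'a list"
      assume "p \<noteq> []" "successively (\<lambda>a b. (a, b) \<in> {}) p" "hd p \<in> A" "last p \<in> B"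
      then show "set p \<inter> (A \<inter> B) \<noteq> {}" by (cases p; cases "tl p") auto
    qed
    then have "k \<le> card (A \<inter> B)" using empty by blast
    then obtain K where K: "K \<subseteq> A \<inter> B" "card K = k" "finite K" by (meson obtain_subset_with_card_n)
    have "linkage (\<lambda>a b. (a, b) \<in> {}) A B ((\<lambda>a. [a]) ` K)" using K unfolding linkage_def by auto
    moreover have "card ((\<lambda>a. [a]) ` K) = k" using K by (simp add: card_image inj_on_def)
    ultimately show ?case using K(3) by blast
  next
    case (insert e D)
    obtain x y where e: "e = (x, y)" by force
    let ?D = "\<lambda>a b. (a, b) \<in> D" and ?R = "\<lambda>a b. (a, b) \<in> D \<or> a = x \<and> b = y"
    have R: "(\<lambda>a b. (a, b) \<in> insert e D) = ?R" using e by auto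
    note min = insert.prems(3)[unfolded R]
    show ?case
    proof (cases "\<forall>S. finite S \<longrightarrow> separates ?D A B S \<longrightarrow> k \<le> card S")
      case True
      then obtain P where "linkage ?D A B P" "finite P" "card P = k"
        using insert.IH[OF insert.prems(1,2)] by auto
      then show ?thesis unfolding R by (intro exI[of _ P]) (auto elim: linkage_mono)
    next
      case False
      then obtain S where S: "finite S" "separates ?D A B S" "card S < k" by auto
      have "\<exists>P. linkage ?D A (insert x S) P \<and> finite P \<and> card P = k"
        by (rule insert.IH)
          (use insert.prems S(1) in simp_all, rule min, assumption, rule separates_insert_edge_tail[OF S(2)])
      then obtain P where P: "linkage ?D A (insert x S) P" "finite P" "card P = k" by (elim exE conjE)
      have "\<exists>Q. linkage ?D (insert y S) B Q \<and> finite Q \<and> card Q = k"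
        by (rule insert.IH)
          (use insert.prems S(1) in simp_all, rule min, assumption, rule separates_insert_edge_head[OF S(2)])
      then obtain Q where Q: "linkage ?D (insert y S) B Q" "finite Q" "card Q = k" by (elim exE conjE)
      have cP: "card (last ` P) = k" "last ` P \<subseteq> insert x S"
        using card_image[OF linkage_inj_last[OF P(1)]] P linkageD(5)[OF P(1)] by auto
      have cQ: "card (hd ` Q) = k" "hd ` Q \<subseteq> insert y S"
        using card_image[OF linkage_inj_hd[OF Q(1)]] Q linkageD(4)[OF Q(1)] by auto
      \<comment> \<open>Disjoint paths have \<open>k\<close> different ends in
        \<open>insert x S\<close>, while \<open>card S < k\<close>. This forces equality, and the
        ends fill the whole set.\<close>
      have "k \<le> card (insert x S)" "k \<le> card (insert y S)"
        using cP cQ S(1) card_mono by (metis finite_insert)+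
      then have xy: "x \<notin> S" "y \<notin> S" "card (insert x S) = k" "card (insert y S) = k"
        using S by (auto simp: card_insert_if split: if_splits)
      then have "last ` P = insert x S" "hd ` Q = insert y S"
        using cP cQ S(1) by (simp_all only: card_subset_eq finite_insert)
      from linkage_join[OF S(2) xy(1,2) P(1) this(1) Q(1) this(2)] P(3)
      obtain L where L: "linkage ?R A B L" "card L = k" by (elim exE conjE) simp
      \<comment> \<open>An infinite \<open>L\<close> would have cardinality 0, but
        \<open>k > card S\<close>.\<close>
      then have "finite L" using S(3) card.infinite by fastforce
      with L show ?thesis unfolding R by blast
    qed
  qed
  have R: "(\<lambda>a b. (a, b) \<in> {(a, b). R a b}) = R" by simp
  show ?thesis by (rule main[OF assms(1-3), unfolded R]) (rule assms(4))
qed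

subsection \<open>Replacing edges by disjoint detours\<close>

lemma is_path_iff_successively:
  "is_path E u v p \<longleftrightarrow>
     p \<noteq> [] \<and> hd p = u \<and> last p = v \<and> distinct p \<and> successively (\<lambda>a b. {a, b} \<in> E) p"
  by (simp add: is_path_def successively_conv_nth)

lemma rtranclp_imp_distinct_path:
  assumes "R\<^sup>*\<^sup>* u v"
  shows "\<exists>p. p \<noteq> [] \<and> hd p = u \<and> last p = v \<and> distinct p \<and> successively R p"
  using assms
proof induction
  case base
  show ?case by (intro exI[of _ "[u]"]) simp
next
  case (step y z)
  then obtain p where p: "p \<noteq> []" "hd p = u" "last p = y" "distinct p" "successively R p" by blast
  show ?case
  proof (cases "z \<in> set p")
    case True
    then obtain p1 p2 where "p = p1 @ z # p2" by (meson split_list)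
    moreover from this have "hd (p1 @ [z]) = u" using p(2) by (cases p1) auto
    ultimately show ?thesis using p
      by (intro exI[of _ "p1 @ [z]"]) (auto simp: successively_append_iff)
  next
    case False
    then show ?thesis using p step(2)
      by (intro exI[of _ "p @ [z]"]) (auto simp: successively_append_iff)
  qed
qed

lemma successively_rtranclp: "successively R\<^sup>*\<^sup>* p \<Longrightarrow> p \<noteq> [] \<Longrightarrow> R\<^sup>*\<^sup>* (hd p) (last p)"
  by (induction p) (auto simp: successively_Cons)

lemma successively_avoids:
  "successively R p \<Longrightarrow> p \<noteq> [] \<Longrightarrow> hd p \<notin> Z \<Longrightarrow> (\<And>a b. R a b \<Longrightarrow> b \<notin> Z) \<Longrightarrow> set p \<inter> Z = {}"
proof (induction p)
  case (Cons a p)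
  then show ?case by (cases "p = []") (auto simp: successively_Cons)
qed simp

lemma vpairsD: "{a, b} \<in> vpairs V \<Longrightarrow> a \<in> V \<and> b \<in> V \<and> a \<noteq> b"
  by (auto simp: vpairs_def doubleton_eq_iff)

lemma has_disjoint_paths_0: "has_disjoint_paths E u v 0"
  unfolding has_disjoint_paths_def by (intro exI[of _ "{}"]) simp

text \<open>Menger's theorem for two vertices that may be adjacent: the edge between them, if present,
  is itself one of the paths and counts as an element of the cut.\<close>

lemma has_disjoint_pathsI:
  assumes "finite V" and X: "X \<subseteq> vpairs V" and "u \<noteq> v"
    and conn: "\<And>F. finite F \<Longrightarrow> F \<inter> {u, v} = {} \<Longrightarrow> card F + (if {u, v} \<in> X then 1 else 0) < m \<Longrightarrow>
      (\<lambda>a b. {a, b} \<in> X \<and> {a, b} \<noteq> {u, v} \<and> a \<notin> F \<and> b \<notin> F)\<^sup>*\<^sup>* u v"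
  shows "has_disjoint_paths X u v m"
proof (cases "m = 0")
  case True
  then show ?thesis by (simp add: has_disjoint_paths_0)
next
  case False
  \<comment> \<open>\<open>d\<close> counts the edge \<open>uv\<close> as a path. The other
    \<open>m - d\<close> paths come from Menger's theorem in the graph without \<open>u\<close> and
    \<open>v\<close>, between the neighbours of \<open>u\<close> and those of
    \<open>v\<close>.\<close>
  define d :: nat where "d = (if {u, v} \<in> X then 1 else 0)"
  define R where "R a b \<longleftrightarrow> {a, b} \<in> X \<and> a \<notin> {u, v} \<and> b \<notin> {u, v}" for a b
  define A where "A = {a. {u, a} \<in> X \<and> a \<notin> {u, v}}"
  define B where "B = {b. {b, v} \<in> X \<and> b \<notin> {u, v}}"
  have inV: "a \<in> V" "b \<in> V" if "{a, b} \<in> X" for a b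
    using vpairsD[OF subsetD[OF X that]] by simp_all
  have sub: "{(a, b). R a b} \<subseteq> V \<times> V" "A \<subseteq> V" "B \<subseteq> V"
    using inV by (auto simp: R_def A_def B_def)
  have fin: "finite {(a, b). R a b}" "finite A" "finite B"
    using sub[THEN finite_subset] \<open>finite V\<close> by simp_all
  have "\<exists>P. linkage R A B P \<and> finite P \<and> card P = m - d"
  proof (rule menger[OF fin])
    fix S assume S: "finite S" "separates R A B S"
    show "m - d \<le> card S"
    proof (rule ccontr)
      assume "\<not> m - d \<le> card S"
      \<comment> \<open>\<open>conn\<close> requires a fault set without \<open>u\<close> and
        \<open>v\<close>; dropping them from \<open>S\<close> cannot enlarge it.\<close>
      moreover have "card (S - {u, v}) \<le> card S" using S(1) by (simp add: card_mono)
      ultimately have "card (S - {u, v}) + (if {u, v} \<in> X then 1 else 0) < m"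
        unfolding d_def[symmetric] by linarith
      from conn[OF _ _ this] S(1)
      have "(\<lambda>a b. {a, b} \<in> X \<and> {a, b} \<noteq> {u, v} \<and> a \<notin> S - {u, v} \<and> b \<notin> S - {u, v})\<^sup>*\<^sup>* u v"
        (is "?C\<^sup>*\<^sup>* u v") by auto
      from rtranclp_imp_distinct_path[OF this] obtain p where
        p: "p \<noteq> []" "hd p = u" "last p = v" "distinct p" "successively ?C p" by (elim exE conjE)
      obtain p' where p': "p = u # p'" using p(1,2) by (cases p) auto
      then obtain q where pq: "p = u # q @ [v]" using p(3) \<open>u \<noteq> v\<close> by (cases p' rule: rev_cases) auto
      \<comment> \<open>\<open>?C\<close> excludes the edge \<open>uv\<close>, so the path has an
        interior.\<close>
      have q: "q \<noteq> []" using p(5) pq by auto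
      have uv: "u \<notin> set q" "v \<notin> set q" using p(4) pq by auto
      have sq: "successively ?C q" using p(5) pq q by (simp add: successively_append_iff successively_Cons)
      have C1: "?C u (hd q)" "?C (last q) v"
        using p(5) pq q by (auto simp: successively_append_iff successively_Cons)
      have "successively R q" using sq
      proof (rule successively_mono)
        fix a b assume "a \<in> set q" "b \<in> set q" "?C a b"
        then show "R a b" using uv by (auto simp: R_def)
      qed
      moreover have "hd q \<in> A" "last q \<in> B"
        using C1 uv q hd_in_set[OF q] last_in_set[OF q] by (auto simp: A_def B_def)
      ultimately have "set q \<inter> S \<noteq> {}" using separatesD[OF S(2) q] by simp
      moreover have "set q \<inter> (S - {u, v}) = {}"
        by (rule successively_avoids[OF sq q]) (use C1 in auto)
      ultimately show False using uv by auto
    qed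
  qed
  then obtain P where P: "linkage R A B P" "finite P" "card P = m - d" by blast
  have av: "u \<notin> set p" "v \<notin> set p" if "p \<in> P" for p
  proof -
    have "set p \<inter> {u, v} = {}"
      using linkageD[OF P(1) that] by (intro successively_avoids[of R p]) (auto simp: A_def R_def)
    then show "u \<notin> set p" "v \<notin> set p" by auto
  qed
  let ?e = "\<lambda>p. u # p @ [v]"
  define D where "D = (if {u, v} \<in> X then {[u, v]} else {})"
  have path: "is_path X u v (?e p)" if "p \<in> P" for p
  proof -
    note l = linkageD[OF P(1) that]
    have "successively (\<lambda>a b. {a, b} \<in> X) p" using l(2) by (auto simp: R_def intro: successively_mono)
    then show ?thesis using l av[OF that] \<open>u \<noteq> v\<close>
      by (auto simp: is_path_iff_successively successively_append_iff successively_Cons A_def B_def)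
  qed
  have "?e ` P \<inter> D = {}" using linkageD(1)[OF P(1)] by (auto simp: D_def)
  moreover have "card (?e ` P) = m - d" using P(3) by (simp add: card_image inj_on_def)
  moreover have "card D = d" "finite D" by (auto simp: D_def d_def)
  \<comment> \<open>Here \<open>m \<noteq> 0\<close> matters: it makes \<open>m - d + d = m\<close>
    for natural numbers.\<close>
  moreover have "d \<le> m" using False by (auto simp: d_def)
  ultimately have "card (?e ` P \<union> D) = m" using P(2) by (simp add: card_Un_disjoint)
  moreover have "is_path X u v p" if "p \<in> ?e ` P \<union> D" for p
    using that path \<open>u \<noteq> v\<close> by (auto simp: D_def is_path_iff_successively split: if_splits)
  moreover have "(set p - {u, v}) \<inter> (set q - {u, v}) = {}"
    if "p \<in> ?e ` P \<union> D" "q \<in> ?e ` P \<union> D" "p \<noteq> q" for p q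
    using that linkage_disjoint[OF P(1)] by (auto simp: D_def split: if_splits)
  ultimately show ?thesis
    unfolding has_disjoint_paths_def using P(2) \<open>finite D\<close> by (intro exI[of _ "?e ` P \<union> D"]) simp
qed

text \<open>Pigeonhole: \<open>F\<close> avoids the ends, so each vertex of \<open>F\<close> blocks
  at most one path, and \<open>D\<close> rules out at most \<open>card D\<close> more.\<close>

lemma exists_path_avoiding:
  assumes "finite F" and "finite D" and "F \<inter> {u, v} = {}"
    and disj: "\<forall>p\<in>P. \<forall>q\<in>P. p \<noteq> q \<longrightarrow> (set p - {u, v}) \<inter> (set q - {u, v}) = {}"
    and "card F + card D < card P"
  shows "\<exists>p\<in>P - D. set p \<inter> F = {}"
proof (rule ccontr)
  assume "\<not> ?thesis"
  then have "\<forall>p\<in>P - D. \<exists>z. z \<in> set p \<and> z \<in> F" by blast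
  then obtain h where h: "\<forall>p\<in>P - D. h p \<in> set p \<and> h p \<in> F" by metis
  have "inj_on h (P - D)"
  proof (rule inj_onI)
    fix p q assume "p \<in> P - D" "q \<in> P - D" "h p = h q"
    moreover from this have "h p \<in> (set p - {u, v}) \<inter> (set q - {u, v})"
      using h \<open>F \<inter> {u, v} = {}\<close> by (metis Diff_iff IntI empty_iff)
    ultimately show "p = q" using disj by blast
  qed
  moreover have "h ` (P - D) \<subseteq> F" using h by blast
  ultimately have "card (P - D) \<le> card F" using \<open>finite F\<close> by (meson card_inj_on_le)
  moreover have "card P - card D \<le> card (P - D)" using \<open>finite D\<close> by (rule diff_card_le_card_Diff)
  ultimately show False using assms(5) by linarith
qed

text \<open>On a distinct list the two ends are adjacent only if there is nothing between
  them.\<close>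

lemma is_path_avoids_end_edge:
  assumes "is_path E u v p" and "p \<noteq> [u, v]" and "Suc i < length p"
  shows "{p ! i, p ! Suc i} \<noteq> {u, v}"
proof
  assume eq: "{p ! i, p ! Suc i} = {u, v}"
  have p: "p \<noteq> []" "distinct p" "u = p ! 0" "v = p ! (length p - 1)"
    using assms(1) by (auto simp: is_path_def hd_conv_nth last_conv_nth)
  have "i = 0 \<and> Suc i = length p - 1"
    using eq assms(3) p(1) nth_eq_iff_index_eq[OF p(2)] unfolding p(3,4) doubleton_eq_iff by auto
  then have "length p = 2" by linarith
  then have "p = [u, v]" using p by (cases p; cases "tl p") auto
  with assms(2) show False by simp
qed

text \<open>By \<open>has_disjoint_pathsI\<close> it is enough to connect \<open>u\<close> and
  \<open>v\<close> outside a small fault set \<open>F\<close> and without the edge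
  \<open>uv\<close>. Some path of \<open>Y\<close> survives, and each of its edges missing from
  \<open>X\<close> has \<open>k \<ge> m\<close> detours, too many for \<open>F\<close> and the edge
  \<open>uv\<close> to block.\<close>

lemma has_disjoint_paths_replace_edges:
  assumes "finite V" and X: "X \<subseteq> vpairs V" and "u \<noteq> v"
    and paths: "has_disjoint_paths Y u v m" and "m \<le> k"
    and detour: "\<And>e. e \<in> Y \<Longrightarrow> e \<notin> X \<Longrightarrow> \<exists>x y. e = {x, y} \<and> has_disjoint_paths X x y k"
  shows "has_disjoint_paths X u v m"
proof (rule has_disjoint_pathsI[OF \<open>finite V\<close> X \<open>u \<noteq> v\<close>])
  fix F assume F: "finite F" "F \<inter> {u, v} = {}" "card F + (if {u, v} \<in> X then 1 else 0) < m"
  define C where "C a b \<longleftrightarrow> {a, b} \<in> X \<and> {a, b} \<noteq> {u, v} \<and> a \<notin> F \<and> b \<notin> F" for a b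
  have "symp C" by (auto simp: symp_def C_def insert_commute)
  then have C_sym: "C\<^sup>*\<^sup>* a b \<Longrightarrow> C\<^sup>*\<^sup>* b a" for a b using symp_rtranclp by (metis sympD)
  have edge: "C\<^sup>*\<^sup>* a b"
    if ab: "{a, b} \<in> Y" "a \<notin> F" "b \<notin> F" "{u, v} \<in> X \<longrightarrow> {a, b} \<noteq> {u, v}" for a b
  proof (cases "{a, b} \<in> X")
    case True
    then show ?thesis using ab by (intro r_into_rtranclp) (auto simp: C_def)
  next
    case False
    then obtain x y where xy: "{a, b} = {x, y}" "has_disjoint_paths X x y k" using detour ab(1) by blast
    then obtain P where P: "finite P" "card P = k" "\<forall>p\<in>P. is_path X x y p"
      "\<forall>p\<in>P. \<forall>q\<in>P. p \<noteq> q \<longrightarrow> (set p - {x, y}) \<inter> (set q - {x, y}) = {}"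
      unfolding has_disjoint_paths_def by blast
    \<comment> \<open>These are the detours that could run through the edge
      \<open>uv\<close>.\<close>
    define D where "D = {p \<in> P. {u, v} \<in> X \<and> u \<in> set p \<and> v \<in> set p}"
    have D: "finite D" using P(1) by (simp add: D_def)
    have "card D \<le> (if {u, v} \<in> X then 1 else 0)"
    proof (cases "{u, v} \<in> X")
      case True
      then have "{u, v} \<noteq> {x, y}" using ab(4) xy(1) by metis
      \<comment> \<open>One of \<open>u\<close>, \<open>v\<close> is not an end of the detours, so
        by disjointness at most one detour contains it.\<close>
      then have "\<exists>z\<in>{u, v}. z \<notin> {x, y}" using \<open>u \<noteq> v\<close> by auto
      then obtain z where z: "z \<in> {u, v}" "z \<notin> {x, y}" by blast
      have "p = q" if "p \<in> D" "q \<in> D" for p q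
      proof (rule ccontr)
        assume "p \<noteq> q"
        moreover have "z \<in> set p - {x, y}" "z \<in> set q - {x, y}" using that z by (auto simp: D_def)
        ultimately show False using P(4) that by (auto simp: D_def)
      qed
      then show ?thesis using True D by (simp add: card_le_Suc0_iff_eq)
    qed (simp add: D_def)
    then have "card F + card D < card P" using F(3) P(2) \<open>m \<le> k\<close> by linarith
    moreover have Fxy: "F \<inter> {x, y} = {}" using ab(2,3) unfolding xy(1)[symmetric] by blast
    ultimately obtain p where p: "p \<in> P" "p \<notin> D" "set p \<inter> F = {}"
      using exists_path_avoiding[OF F(1) D _ P(4)] by blast
    have pp: "p \<noteq> []" "hd p = x" "last p = y" "successively (\<lambda>a b. {a, b} \<in> X) p"
      using P(3) p(1) by (auto simp: is_path_iff_successively)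
    have "successively C\<^sup>*\<^sup>* p" using pp(4)
    proof (rule successively_mono)
      fix c d assume cd: "{c, d} \<in> X" "c \<in> set p" "d \<in> set p"
      then have "{c, d} \<noteq> {u, v}" using p(1,2) unfolding D_def by (auto simp: doubleton_eq_iff insert_commute)
      then show "C\<^sup>*\<^sup>* c d" using cd p(3) by (intro r_into_rtranclp) (auto simp: C_def)
    qed
    then have "C\<^sup>*\<^sup>* x y" using successively_rtranclp pp by metis
    then show ?thesis using xy(1) C_sym by (auto simp: doubleton_eq_iff)
  qed
  obtain P where P: "finite P" "card P = m" "\<forall>p\<in>P. is_path Y u v p"
      "\<forall>p\<in>P. \<forall>q\<in>P. p \<noteq> q \<longrightarrow> (set p - {u, v}) \<inter> (set q - {u, v}) = {}"
    using paths unfolding has_disjoint_paths_def by blast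
  \<comment> \<open>\<open>[u, v]\<close> is the only path from \<open>u\<close> to \<open>v\<close>
    that uses the edge \<open>uv\<close>.\<close>
  define D where "D = (if {u, v} \<in> X then {[u, v]} else {})"
  have "card F + card D < card P" "finite D" using F(3) P(2) by (auto simp: D_def)
  then obtain p where p: "p \<in> P" "p \<notin> D" "set p \<inter> F = {}"
    using exists_path_avoiding[OF F(1) _ F(2) P(4)] by blast
  have path: "is_path Y u v p" using P(3) p(1) by blast
  have "successively C\<^sup>*\<^sup>* p"
    unfolding successively_conv_nth
  proof (intro allI impI)
    fix i assume i: "Suc i < length p"
    have "p ! i \<notin> F" "p ! Suc i \<notin> F" using i p(3) by (auto simp: disjoint_iff)
    moreover have "{u, v} \<in> X \<longrightarrow> {p ! i, p ! Suc i} \<noteq> {u, v}"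
      using is_path_avoids_end_edge[OF path _ i] p(2) by (auto simp: D_def)
    moreover have "{p ! i, p ! Suc i} \<in> Y" using path i by (simp add: is_path_def)
    ultimately show "C\<^sup>*\<^sup>* (p ! i) (p ! Suc i)" using edge by blast
  qed
  then have "C\<^sup>*\<^sup>* u v" using successively_rtranclp path by (fastforce simp: is_path_def)
  then show "(\<lambda>a b. {a, b} \<in> X \<and> {a, b} \<noteq> {u, v} \<and> a \<notin> F \<and> b \<notin> F)\<^sup>*\<^sup>* u v"
    unfolding C_def[abs_def] .
qed

subsection \<open>The greedy spanner\<close>

definition path_edges :: "'a list \<Rightarrow> 'a set set" where
  "path_edges p = (\<lambda>i. {p ! i, p ! Suc i}) ` {i. Suc i < length p}"

lemma card_path_edges: "card (path_edges p) \<le> length p - 1"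
proof -
  have "{i. Suc i < length p} = {..<length p - 1}" by auto
  then show ?thesis unfolding path_edges_def by (metis card_image_le card_lessThan finite_lessThan)
qed

lemma is_path_mono: "is_path E u v p \<Longrightarrow> E \<subseteq> E' \<Longrightarrow> is_path E' u v p"
  unfolding is_path_def by blast

lemma path_edges_subset: "is_path E u v p \<Longrightarrow> path_edges p \<subseteq> E"
  unfolding is_path_def path_edges_def by blast

lemma is_path_path_edges: "is_path E u v p \<Longrightarrow> path_edges p \<subseteq> E' \<Longrightarrow> is_path E' u v p"
  unfolding is_path_def path_edges_def by blast

text \<open>With distinct ends a path has at least two vertices, so each vertex lies on one of its
  edges.\<close>

lemma is_path_subset_vertices:
  assumes "is_path E u v p" and "u \<noteq> v" and "\<And>e. e \<in> E \<Longrightarrow> e \<subseteq> U"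
  shows "set p \<subseteq> U"
proof
  fix z assume "z \<in> set p"
  then obtain i where i: "i < length p" "z = p ! i" by (auto simp: in_set_conv_nth)
  have "length p \<noteq> 1" using assms(1,2) by (auto simp: is_path_def length_Suc_conv)
  then have "Suc i < length p \<or> (\<exists>j. i = Suc j)" using i(1) by presburger
  then obtain e where "e \<in> E" "z \<in> e" using assms(1) i unfolding is_path_def by blast
  then show "z \<in> U" using assms(3) by blast
qed

text \<open>It guarantees that a detour for a missing edge has an interior vertex.\<close>

lemma is_path_interior_empty:
  assumes "is_path E u v p" and "u \<noteq> v" and "set p \<subseteq> {u, v}"
  shows "{u, v} \<in> E"
proof -
  have p: "p \<noteq> []" "hd p = u" "last p = v" "distinct p" using assms(1) by (auto simp: is_path_def)
  have "length p \<le> card {u, v}" using p(4) assms(3) by (metis card_mono distinct_card finite.emptyI finite.insertI)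
  then have "length p \<le> 2" using assms(2) by simp
  then have "p = [u, v]" using p \<open>u \<noteq> v\<close> by (cases p; cases "tl p") auto
  then show ?thesis using assms(1) by (auto simp: is_path_def)
qed

lemma hop_dist_leD:
  assumes "hop_dist E u v \<le> enat n"
  shows "\<exists>p. is_path E u v p \<and> length p \<le> Suc n"
proof (rule ccontr)
  assume "\<not> ?thesis"
  then have "enat (Suc n) \<le> hop_dist E u v"
    unfolding hop_dist_def by (intro INF_greatest) (auto simp: not_le)
  then have "enat (Suc n) \<le> enat n" using assms by (rule order_trans)
  then show False by simp
qed

section \<open>Monotonicity and runs of the greedy algorithm\<close>

lemma hop_dist_antimono: "E \<subseteq> E' \<Longrightarrow> hop_dist E' u v \<le> hop_dist E u v"
  unfolding hop_dist_def by (rule INF_superset_mono) (auto intro: is_path_mono)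

text \<open>Removing edges only increases distances, so the same fault set remains a
  witness.\<close>

lemma vft_add_antimono:
  assumes "vft_add V t f H' e" and "H \<subseteq> H'"
  shows "vft_add V t f H e"
proof -
  obtain u v F where *: "e = {u, v}" "F \<subseteq> V - {u, v}" "int (card F) \<le> f"
    "hop_dist (induced_edges H' (V - F)) u v > enat (2 * t - 1)"
    using assms(1) unfolding vft_add_def by blast
  have "induced_edges H (V - F) \<subseteq> induced_edges H' (V - F)"
    using assms(2) by (auto simp: induced_edges_def)
  from less_le_trans[OF *(4) hop_dist_antimono[OF this]] show ?thesis
    using * unfolding vft_add_def by blast
qed

lemma vft_fold_subset:
  "fold (vft_step V w t f \<epsilon> T) es (\<lambda>_. {}) j \<subseteq> {e \<in> set es. real (w e) \<in> bucket \<epsilon> j}"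
  by (induction es rule: rev_induct) (auto simp: vft_step_def split: if_splits)

text \<open>The edge sets only grow during the run, so an edge that was rejected when it arrived would
  also be rejected by the final graph of its bucket.\<close>

lemma vft_fold_rejected:
  assumes "e \<in> set es" and "j \<le> T" and "real (w e) \<in> bucket \<epsilon> j"
    and "e \<notin> fold (vft_step V w t f \<epsilon> T) es (\<lambda>_. {}) j"
  shows "\<not> vft_add V t f (fold (vft_step V w t f \<epsilon> T) es (\<lambda>_. {}) j) e"
  using assms
proof (induction es rule: rev_induct)
  case (snoc a es)
  let ?H = "fold (vft_step V w t f \<epsilon> T) es (\<lambda>_. {})"
  have mono: "?H j \<subseteq> vft_step V w t f \<epsilon> T a ?H j" by (auto simp: vft_step_def)
  show ?case
  proof (cases "e \<in> set es")
    case True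
    then have "\<not> vft_add V t f (?H j) e" using snoc mono by auto
    then show ?thesis using vft_add_antimono[OF _ mono] by auto
  next
    case False
    \<comment> \<open>The arrival of \<open>e\<close> is the last step: \<open>e\<close> was tested
      against \<open>?H j\<close>, and its rejection left that graph unchanged.\<close>
    then have "a = e" using snoc.prems(1) by simp
    then show ?thesis using snoc.prems by (auto simp: vft_step_def split: if_splits)
  qed
qed simp

lemma not_vft_add_disjoint_paths:
  assumes "x \<noteq> y" and nadd: "\<not> vft_add V t f H {x, y}" and "{x, y} \<notin> H"
    and "t \<ge> 1" and f: "f = (2 * int t - 2) * (int k - 1)" and "m \<le> k"
  shows "\<exists>P. finite P \<and> card P = m \<and>
    (\<forall>p\<in>P. is_path H x y p \<and> length p \<le> 2 * t \<and> set p \<subseteq> V) \<and>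
    (\<forall>p\<in>P. \<forall>q\<in>P. p \<noteq> q \<longrightarrow> (set p - {x, y}) \<inter> (set q - {x, y}) = {})"
  using \<open>m \<le> k\<close>
proof (induction m)
  case 0
  show ?case by (intro exI[of _ "{}"]) simp
next
  case (Suc m)
  then obtain P where P: "finite P" "card P = m"
    "\<And>p. p \<in> P \<Longrightarrow> is_path H x y p" "\<And>p. p \<in> P \<Longrightarrow> length p \<le> 2 * t" "\<And>p. p \<in> P \<Longrightarrow> set p \<subseteq> V"
    "\<forall>p\<in>P. \<forall>q\<in>P. p \<noteq> q \<longrightarrow> (set p - {x, y}) \<inter> (set q - {x, y}) = {}"
    by auto
  \<comment> \<open>The faults are the interior vertices of all paths found so far.\<close>
  define F where "F = (\<Union>p\<in>P. set p - {x, y})"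
  have F: "F \<subseteq> V - {x, y}" using P(5) by (auto simp: F_def)
  have interior: "card (set p - {x, y}) \<le> 2 * t - 2" if "p \<in> P" for p
  proof -
    have "{x, y} \<subseteq> set p" using P(3)[OF that] by (auto simp: is_path_def)
    then have "card (set p - {x, y}) = card (set p) - 2"
      using \<open>x \<noteq> y\<close> by (simp add: card_Diff_subset)
    also have "\<dots> \<le> 2 * t - 2" using P(4)[OF that] card_length[of p] by linarith
    finally show ?thesis .
  qed
  have "card F \<le> (\<Sum>p\<in>P. card (set p - {x, y}))"
    unfolding F_def by (rule card_UN_le) (rule P(1))
  also have "\<dots> \<le> m * (2 * t - 2)" using sum_bounded_above[of P _ "2 * t - 2"] interior P(2) by simp
  also have "\<dots> \<le> (k - 1) * (2 * t - 2)" using Suc.prems by (intro mult_right_mono) auto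
  finally have "int (card F) \<le> int ((k - 1) * (2 * t - 2))" by (rule of_nat_mono)
  \<comment> \<open>As \<open>k\<close> and \<open>t\<close> are at least 1, truncated subtraction
    agrees with the integer one in \<open>f\<close>.\<close>
  also have "\<dots> = f" using Suc.prems \<open>t \<ge> 1\<close> f by (simp add: mult.commute)
  finally have "int (card F) \<le> f" .
  then have "hop_dist (induced_edges H (V - F)) x y \<le> enat (2 * t - 1)"
    using nadd F unfolding vft_add_def not_less[symmetric] by blast
  then obtain q where q: "is_path (induced_edges H (V - F)) x y q" "length q \<le> 2 * t"
    using hop_dist_leD \<open>t \<ge> 1\<close> by fastforce
  have qV: "set q \<subseteq> V - F"
    by (rule is_path_subset_vertices[OF q(1) \<open>x \<noteq> y\<close>]) (auto simp: induced_edges_def)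
  have qH: "is_path H x y q" using q(1) by (rule is_path_mono) (auto simp: induced_edges_def)
  \<comment> \<open>A path already in \<open>P\<close> has its interior in \<open>F\<close>, so
    \<open>q\<close> would have none and would be the edge \<open>xy\<close>, which is not in
    \<open>H\<close>.\<close>
  have "q \<notin> P"
  proof
    assume "q \<in> P"
    then have "set q \<subseteq> {x, y}" using qV by (auto simp: F_def)
    then show False using is_path_interior_empty[OF qH \<open>x \<noteq> y\<close>] \<open>{x, y} \<notin> H\<close> by blast
  qed
  moreover have "(set q - {x, y}) \<inter> (set p - {x, y}) = {}" if "p \<in> P" for p
    using that qV by (auto simp: F_def)
  ultimately show ?case using P q(2) qH qV
    by (intro exI[of _ "insert q P"]) (auto simp: card_insert_if Int_commute)
qed

section \<open>Weight of the detours\<close>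

text \<open>A positive bucket spans a factor \<open>1 + \<epsilon>\<close>, and bucket 0 contains
  only 0.\<close>

lemma bucket_ratio:
  assumes "real a \<in> bucket \<epsilon> j" and "real b \<in> bucket \<epsilon> j" and "\<epsilon> \<ge> 0"
  shows "real a \<le> (1 + \<epsilon>) * real b"
proof (cases j)
  case (Suc i)
  then have "real a \<le> (1 + \<epsilon>) * (1 + \<epsilon>) ^ i" "(1 + \<epsilon>) ^ i \<le> real b" using assms by auto
  moreover have "(1 + \<epsilon>) * (1 + \<epsilon>) ^ i \<le> (1 + \<epsilon>) * real b"
    using calculation(2) assms(3) by (intro mult_left_mono) auto
  ultimately show ?thesis by linarith
qed (use assms in simp)

lemma sum_UN_le:
  fixes g :: "'b \<Rightarrow> nat"
  assumes "finite I" and "\<And>i. i \<in> I \<Longrightarrow> finite (A i)"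
  shows "sum g (\<Union>i\<in>I. A i) \<le> (\<Sum>i\<in>I. sum g (A i))"
  using assms
proof (induction I)
  case (insert i I)
  have "sum g (A i \<union> (\<Union>i\<in>I. A i)) \<le> sum g (A i) + sum g (\<Union>i\<in>I. A i)"
    using sum.union_inter[of "A i" "\<Union>i\<in>I. A i" g] insert by simp
  then show ?case using insert by simp
qed simp

text \<open>The detours stay in the bucket graph of \<open>e\<close>, so each of their at most
  \<open>k * (2 * t - 1)\<close> edges costs at most \<open>(1 + \<epsilon>) * w e\<close>.\<close>

lemma vft_spanner_detour:
  fixes V :: "'a set" and w :: "'a set \<Rightarrow> nat" and es :: "'a set list"
  assumes H: "H = vft_spanner V w t f \<epsilon> T es" and E: "set es \<subseteq> vpairs V" and "t \<ge> 1"
    and f: "f = (2 * int t - 2) * (int k - 1)" and eps: "\<epsilon> = 1 / (2 * real t - 1)"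
    and e: "e \<in> set es" "e \<notin> H" and j: "j \<le> T" "real (w e) \<in> bucket \<epsilon> j"
  shows "\<exists>D. D \<subseteq> H \<and> (\<exists>x y. e = {x, y} \<and> has_disjoint_paths D x y k) \<and> sum w D \<le> 2 * t * k * w e"
proof -
  define Hj where "Hj = fold (vft_step V w t f \<epsilon> T) es (\<lambda>_. {}) j"
  have HjH: "Hj \<subseteq> H" using j(1) by (auto simp: H vft_spanner_def Hj_def)
  have nadd: "\<not> vft_add V t f Hj e"
    using vft_fold_rejected[of e es j T w \<epsilon> V t f, OF e(1) j] HjH e(2) unfolding Hj_def by blast
  obtain x y where xy: "e = {x, y}" "x \<noteq> y" using e(1) E by (auto simp: vpairs_def)
  obtain P where P: "finite P" "card P = k" "\<And>p. p \<in> P \<Longrightarrow> is_path Hj x y p"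
    "\<And>p. p \<in> P \<Longrightarrow> length p \<le> 2 * t"
    "\<forall>p\<in>P. \<forall>q\<in>P. p \<noteq> q \<longrightarrow> (set p - {x, y}) \<inter> (set q - {x, y}) = {}"
    using not_vft_add_disjoint_paths[OF xy(2) _ _ \<open>t \<ge> 1\<close> f order_refl, of V Hj]
      nadd xy HjH e(2) by blast
  define D where "D = (\<Union>p\<in>P. path_edges p)"
  have DHj: "D \<subseteq> Hj" using path_edges_subset P(3) by (fastforce simp: D_def)
  have "is_path D x y p" if "p \<in> P" for p
    using is_path_path_edges[OF P(3)[OF that], of D] that by (auto simp: D_def)
  then have "has_disjoint_paths D x y k" unfolding has_disjoint_paths_def using P by blast
  moreover have "sum w D \<le> 2 * t * k * w e"
  proof -
    have pos: "2 * real t - 1 > 0" using \<open>t \<ge> 1\<close> by linarith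
    have le: "real (w d) \<le> (1 + \<epsilon>) * real (w e)" if "d \<in> D" for d
    proof -
      have "real (w d) \<in> bucket \<epsilon> j"
        using vft_fold_subset[of V w t f \<epsilon> T es j] DHj that unfolding Hj_def by blast
      then show ?thesis using j(2) by (rule bucket_ratio) (use pos eps in simp)
    qed
    have "card D \<le> (\<Sum>p\<in>P. card (path_edges p))" unfolding D_def by (rule card_UN_le[OF P(1)])
    also have "\<dots> \<le> k * (2 * t - 1)"
      using sum_bounded_above[of P "\<lambda>p. card (path_edges p)" "2 * t - 1"] P(2,4) card_path_edges
      by (metis (no_types, lifting) diff_le_mono le_trans of_nat_id)
    finally have "real (card D) \<le> real (k * (2 * t - 1))" by (rule of_nat_mono)
    then have cD: "real (card D) \<le> real k * (2 * real t - 1)" using \<open>t \<ge> 1\<close> by simp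
    have "real (sum w D) \<le> real (card D) * ((1 + \<epsilon>) * real (w e))"
      using sum_bounded_above[of D "\<lambda>d. real (w d)"] le by simp
    also have "\<dots> \<le> real k * (2 * real t - 1) * ((1 + \<epsilon>) * real (w e))"
      using cD pos eps by (intro mult_right_mono) auto
    also have "\<dots> = real k * ((2 * real t - 1) * (1 + \<epsilon>)) * real (w e)" by simp
    \<comment> \<open>The choice of \<open>\<epsilon>\<close> makes \<open>1 + \<epsilon>\<close>
      equal to \<open>2t / (2t - 1)\<close>.\<close>
    also have "(2 * real t - 1) * (1 + \<epsilon>) = 2 * real t" using pos eps by (simp add: field_simps)
    finally have "real (sum w D) \<le> real (2 * t * k * w e)" by (simp add: algebra_simps)
    then show ?thesis by linarith
  qed
  ultimately show ?thesis using DHj HjH xy(1) by blast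
qed

section \<open>Optimal solutions and the approximation bound\<close>

lemma has_disjoint_paths_mono: "E \<subseteq> E' \<Longrightarrow> has_disjoint_paths E u v m \<Longrightarrow> has_disjoint_paths E' u v m"
  unfolding has_disjoint_paths_def by (erule ex_forward) (simp add: is_path_mono[of E])

lemma finite_vpairs: "finite V \<Longrightarrow> finite (vpairs V)"
  by (rule finite_subset[of _ "Pow V"]) (auto simp: vpairs_def)

lemma finite_solution_weights:
  assumes "finite E" shows "finite {\<Sum>e\<in>X. w e | X. vc_sndp_solution V E r X}"
proof -
  have "{\<Sum>e\<in>X. w e | X. vc_sndp_solution V E r X} \<subseteq> sum w ` Pow E" by (auto simp: vc_sndp_solution_def)
  then show ?thesis using assms finite_subset by blast
qed

lemma vc_sndp_opt_le:
  "finite E \<Longrightarrow> vc_sndp_solution V E r X \<Longrightarrow> vc_sndp_opt V E r w \<le> sum w X"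
  unfolding vc_sndp_opt_def by (rule Min_le[OF finite_solution_weights]) auto

lemma vc_sndp_opt_attained:
  assumes "finite E" and "vc_sndp_feasible V E r"
  obtains X where "vc_sndp_solution V E r X" and "sum w X = vc_sndp_opt V E r w"
proof -
  have "{\<Sum>e\<in>X. w e | X. vc_sndp_solution V E r X} \<noteq> {}"
    using assms(2) by (auto simp: vc_sndp_feasible_def)
  from Min_in[OF finite_solution_weights[OF assms(1)] this]
  show ?thesis using that unfolding vc_sndp_opt_def by auto
qed

theorem theorem3p2:
  fixes V :: "'a set" and E H :: "'a set set" and w r :: "'a set \<Rightarrow> nat"
    and n W k t T :: nat and \<epsilon> :: real and f :: int and es :: "'a set list"
  assumes "ugraph V E" and "card V = n"
    and "\<forall>e\<in>E. w e \<le> W"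
    and "vc_sndp_feasible V E r"
    and "k = Max (r ` vpairs V)"
    and "t \<ge> 1"
    and "f = (2 * int t - 2) * (int k - 1)"
    and "\<epsilon> = 1 / (2 * real t - 1)"
    and "\<forall>x\<in>{1..W}. \<exists>i\<in>{1..T}. real x \<in> bucket \<epsilon> i"
    and "distinct es" and "set es = E"
    and "H = vft_spanner V w t f \<epsilon> T es"
  shows "vc_sndp_feasible V H r \<and> vc_sndp_opt V H r w \<le> 2 * t * k * vc_sndp_opt V E r w"
proof -
  have V: "finite V" and E: "E \<subseteq> vpairs V" using assms(1) by (auto simp: ugraph_def)
  have HE: "H \<subseteq> E"
    using vft_fold_subset[of V w t f \<epsilon> T es] assms(11,12) unfolding vft_spanner_def by blast
  have finE: "finite E" using E finite_vpairs[OF V] by (rule finite_subset)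
  have finH: "finite H" using HE finE by (rule finite_subset)
  have "\<exists>X. vc_sndp_solution V H r X \<and> sum w X \<le> 2 * t * k * vc_sndp_opt V E r w"
  \<comment> \<open>If all requirements vanish, the empty solution has weight 0. This covers graphs
    with fewer than two vertices, where \<open>k\<close> is the unspecified \<open>Max {}\<close>,
    and the case \<open>k = 0\<close>, where the claimed bound is 0.\<close>
  proof (cases "\<forall>u\<in>V. \<forall>v\<in>V. u \<noteq> v \<longrightarrow> r {u, v} = 0")
    case True
    then have "vc_sndp_solution V H r {}" by (simp add: vc_sndp_solution_def has_disjoint_paths_0)
    then show ?thesis by (intro exI[of _ "{}"]) simp
  next
    case False
    have r_le: "r {u, v} \<le> k" if "u \<in> V" "v \<in> V" "u \<noteq> v" for u v
      using that finite_vpairs[OF V] unfolding assms(5) by (intro Max_ge) (auto simp: vpairs_def)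
    have k: "k \<ge> 1" using False r_le by (metis less_one not_le le_zero_eq)
    obtain X where X: "vc_sndp_solution V E r X" "sum w X = vc_sndp_opt V E r w"
      using vc_sndp_opt_attained[OF finE assms(4)] by blast
    have XE: "X \<subseteq> E" and XP: "\<And>u v. u \<in> V \<Longrightarrow> v \<in> V \<Longrightarrow> u \<noteq> v \<Longrightarrow> has_disjoint_paths X u v (r {u, v})"
      using X(1) by (auto simp: vc_sndp_solution_def)
    have finX: "finite X" using XE finE by (rule finite_subset)
    have "\<forall>e\<in>X - H. \<exists>D. D \<subseteq> H \<and> (\<exists>x y. e = {x, y} \<and> has_disjoint_paths D x y k) \<and> sum w D \<le> 2 * t * k * w e"
    proof
      fix e assume e: "e \<in> X - H"
      have eE: "e \<in> set es" using e XE assms(11) by blast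
      \<comment> \<open>Weight 0 belongs to bucket 0, all other weights to the buckets that cover
        \<open>{1..W}\<close>.\<close>
      obtain j where j: "j \<le> T" "real (w e) \<in> bucket \<epsilon> j"
      proof (cases "w e = 0")
        case True then show ?thesis using that[of 0] by simp
      next
        case False
        then have "w e \<in> {1..W}" using assms(3) eE assms(11) by auto
        then show ?thesis using assms(9) that by (metis atLeastAtMost_iff)
      qed
      show "\<exists>D. D \<subseteq> H \<and> (\<exists>x y. e = {x, y} \<and> has_disjoint_paths D x y k) \<and> sum w D \<le> 2 * t * k * w e"
        using vft_spanner_detour[OF assms(12) _ assms(6-8) eE _ j] E assms(11) e by blast
    qed
    from bchoice[OF this]
    obtain D where D: "\<And>e. e \<in> X - H \<Longrightarrow> D e \<subseteq> H"
      "\<And>e. e \<in> X - H \<Longrightarrow> \<exists>x y. e = {x, y} \<and> has_disjoint_paths (D e) x y k"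
      "\<And>e. e \<in> X - H \<Longrightarrow> sum w (D e) \<le> 2 * t * k * w e"
      by blast
    define Y where "Y = (X \<inter> H) \<union> (\<Union>e\<in>X - H. D e)"
    have YH: "Y \<subseteq> H" using D(1) by (auto simp: Y_def)
    have "has_disjoint_paths Y u v (r {u, v})" if uv: "u \<in> V" "v \<in> V" "u \<noteq> v" for u v
    proof (rule has_disjoint_paths_replace_edges[OF V _ uv(3) XP[OF uv] r_le[OF uv]])
      show "Y \<subseteq> vpairs V" using YH HE E by auto
      fix e assume e: "e \<in> X" "e \<notin> Y"
      \<comment> \<open>\<open>Y\<close> keeps all of \<open>X \<inter> H\<close>, so an edge of
        \<open>X\<close> outside \<open>Y\<close> was rejected by the spanner.\<close>
      then have "e \<in> X - H" by (auto simp: Y_def)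
      moreover from this have "D e \<subseteq> Y" by (auto simp: Y_def)
      ultimately show "\<exists>x y. e = {x, y} \<and> has_disjoint_paths Y x y k"
        using D(2) has_disjoint_paths_mono by metis
    qed
    then have "vc_sndp_solution V H r Y" using YH by (simp add: vc_sndp_solution_def)
    moreover have "sum w Y \<le> 2 * t * k * vc_sndp_opt V E r w"
    proof -
      have finD: "finite (D e)" if "e \<in> X - H" for e using D(1)[OF that] finH by (rule finite_subset)
      \<comment> \<open>Kept edges can thus be charged the same factor as replaced ones, and the two
        sums combine to one over \<open>X\<close>.\<close>
      have "1 \<le> 2 * t * k" using assms(6) k by (simp add: Suc_le_eq)
      then have keep: "w e \<le> 2 * t * k * w e" for e by simp
      have "sum w Y \<le> sum w (X \<inter> H) + sum w (\<Union>e\<in>X - H. D e)"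
        unfolding Y_def using sum.union_inter[of "X \<inter> H" "\<Union>e\<in>X - H. D e" w] finX finD by simp
      also have "sum w (\<Union>e\<in>X - H. D e) \<le> (\<Sum>e\<in>X - H. sum w (D e))"
        using finX finD by (intro sum_UN_le) auto
      also have "\<dots> \<le> (\<Sum>e\<in>X - H. 2 * t * k * w e)" using D(3) by (intro sum_mono)
      also have "sum w (X \<inter> H) \<le> (\<Sum>e\<in>X \<inter> H. 2 * t * k * w e)" using keep by (intro sum_mono)
      finally have "sum w Y \<le> (\<Sum>e\<in>X \<inter> H. 2 * t * k * w e) + (\<Sum>e\<in>X - H. 2 * t * k * w e)" by simp
      also have "\<dots> = (\<Sum>e\<in>X. 2 * t * k * w e)" using finX by (rule sum.Int_Diff[symmetric])
      finally show ?thesis by (simp only: sum_distrib_left[symmetric] X(2))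
    qed
    ultimately show ?thesis by blast
  qed
  then show ?thesis
    using vc_sndp_opt_le[OF finH] unfolding vc_sndp_feasible_def by (meson le_trans)
qed

end
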